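(* Let $n\ge 1$ and let $\omega\in\mathbb{C}$ satisfy $\operatorname{Re}\omega>0$. Let $q\in[1,+\infty]$, $m\in\mathbb{Z}_{>0}$, and $\alpha\in\mathbb{Z}_{\ge 0}^{n}$ with $|\alpha|=m$. Then for every $\varphi\in L^{q}_{m}(\mathbb{R}^{n})$ one has $x^{\alpha}e^{\omega\Delta}\varphi\in L^{q}(\mathbb{R}^{n})$, and the identity $$[x^{\alpha},e^{\omega\Delta}]\varphi=R_{\alpha}(\omega)\varphi$$ holds in $L^{q}(\mathbb{R}^{n})$, where $$R_{\alpha}(\omega)\varphi:=\sum_{\substack{\beta+\gamma=\alpha\\ \beta\neq 0}}\ \sum_{2\kappa\le\beta}\frac{\alpha!}{\gamma!\,\kappa!\,(\beta-2\kappa)!}\,\omega^{|\kappa|}\,(-2\omega\partial)^{\beta-2\kappa}e^{\omega\Delta}(x^{\gamma}\varphi).$$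
   Context: Functions on $\mathbb{R}^n$ are complex-valued; $L^{q}(\mathbb{R}^{n})$ is the Lebesgue space with norm $\|\cdot\|_q$. For $m\in\mathbb{Z}_{>0}$, $$L^{q}_{m}(\mathbb{R}^{n}):=\{\varphi\in L^{q}(\mathbb{R}^{n}) : x^{\alpha}\varphi\in L^{q}(\mathbb{R}^{n})\text{ for all }\alpha\in\mathbb{Z}_{\ge0}^{n}\text{ with }|\alpha|\le m\},$$ where $x^{\alpha}\varphi$ denotes the function $x\mapsto x^{\alpha}\varphi(x)$. For $\omega\in\mathbb{C}\setminus\{0\}$ with $\operatorname{Re}\omega\ge 0$, the complex Gaussian kernel is $G_{\omega}(x):=(4\pi\omega)^{-n/2}\exp(-|x|^{2}/(4\omega))$, $x\in\mathbb{R}^{n}$ (principal branch of the power), and $e^{\omega\Delta}\varphi:=G_{\omega}*\varphi$ (convolution on $\mathbb{R}^{n}$). The commutator is $[x^{\alpha},e^{\omega\Delta}]\varphi:=x^{\alpha}e^{\omega\Delta}\varphi-e^{\omega\Delta}(x^{\alpha}\varphi)$. Multi-index notation: $|\alpha|=\sum_j\alpha_j$, $\alpha!=\prod_j\alpha_j!$, $x^\alpha=\prod_j x_j^{\alpha_j}$, $\partial^\alpha=\prod_j\partial_j^{\alpha_j}$ with $\partial_j=\partial/\partial x_j$, $(-2\omega\partial)^{\beta}=(-2\omega)^{|\beta|}\partial^{\beta}$; $\beta\le\alpha$ means $\beta_j\le\alpha_j$ for all $j$. All summation indices $\beta,\gamma,\kappa$ range over $\mathbb{Z}_{\ge0}^{n}$.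 *)

theory Defs
  imports "HOL-Analysis.Analysis" "HOL-Probability.Essential_Supremum"
begin

text \<open>Points of $R^n$ are vectors of type \<^typ>\<open>real ^ 'n\<close>, so $n = $ \<open>CARD('n)\<close> is at least 1.
  Elements of $L^q$ are represented by Lebesgue measurable functions, and equality in $L^q$
  is equality almost everywhere.\<close>

definition Lq :: "ennreal \<Rightarrow> (real ^ 'n \<Rightarrow> complex) set" where
  "Lq q = {f \<in> borel_measurable lebesgue.
     if q = \<infinity> then esssup lebesgue (\<lambda>x. ereal (norm (f x))) < \<infinity>
     else (\<integral>\<^sup>+x. ennreal (norm (f x) powr enn2real q) \<partial>lebesgue) < \<infinity>}"

type_synonym 'n multi_index = "'n \<Rightarrow> nat"

definition mdeg :: "'n::finite multi_index \<Rightarrow> nat" where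
  "mdeg \<alpha> = (\<Sum>j\<in>UNIV. \<alpha> j)"

definition mfact :: "'n::finite multi_index \<Rightarrow> nat" where
  "mfact \<alpha> = (\<Prod>j\<in>UNIV. fact (\<alpha> j))"

definition mpow :: "real ^ 'n \<Rightarrow> 'n multi_index \<Rightarrow> real" where
  "mpow x \<alpha> = (\<Prod>j\<in>UNIV. (x $ j) ^ \<alpha> j)"

definition xmult :: "'n multi_index \<Rightarrow> (real ^ 'n \<Rightarrow> complex) \<Rightarrow> real ^ 'n \<Rightarrow> complex" where
  "xmult \<alpha> \<phi> = (\<lambda>x. of_real (mpow x \<alpha>) * \<phi> x)"

definition Lq_weighted :: "ennreal \<Rightarrow> nat \<Rightarrow> (real ^ 'n \<Rightarrow> complex) set" where
  "Lq_weighted q m = {\<phi> \<in> Lq q. \<forall>\<alpha>. mdeg \<alpha> \<le> m \<longrightarrow> xmult \<alpha> \<phi> \<in> Lq q}"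

definition gauss_kernel :: "complex \<Rightarrow> real ^ 'n \<Rightarrow> complex" where
  "gauss_kernel \<omega> x = (4 * of_real pi * \<omega>) powr (- (of_nat CARD('n) / 2))
     * exp (- of_real ((norm x)\<^sup>2) / (4 * \<omega>))"

definition convolution ::
    "(real ^ 'n \<Rightarrow> complex) \<Rightarrow> (real ^ 'n \<Rightarrow> complex) \<Rightarrow> real ^ 'n \<Rightarrow> complex" where
  "convolution f g = (\<lambda>x. \<integral>y. f (x - y) * g y \<partial>lebesgue)"

definition heat :: "complex \<Rightarrow> (real ^ 'n \<Rightarrow> complex) \<Rightarrow> real ^ 'n \<Rightarrow> complex" where
  "heat \<omega> \<phi> = convolution (gauss_kernel \<omega>) \<phi>"

definition heat_commutator ::
    "'n multi_index \<Rightarrow> complex \<Rightarrow> (real ^ 'n \<Rightarrow> complex) \<Rightarrow> real ^ 'n \<Rightarrow> complex" where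
  "heat_commutator \<alpha> \<omega> \<phi> = (\<lambda>x. xmult \<alpha> (heat \<omega> \<phi>) x - heat \<omega> (xmult \<alpha> \<phi>) x)"

definition pderiv_at :: "'n \<Rightarrow> (real ^ 'n \<Rightarrow> complex) \<Rightarrow> real ^ 'n \<Rightarrow> complex" where
  "pderiv_at j f = (\<lambda>x. vector_derivative (\<lambda>t. f (x + t *\<^sub>R axis j 1)) (at 0))"

text \<open>The composition of the powers of the partial derivatives is taken along a fixed enumeration
  of the coordinates; on smooth functions the choice of the enumeration is immaterial.\<close>

definition coords :: "'n::finite list" where
  "coords = (SOME js. distinct js \<and> set js = UNIV)"

lemma distinct_coords: "distinct (coords :: 'n::finite list)"
  and set_coords: "set (coords :: 'n::finite list) = UNIV"
proof -
  have "\<exists>js :: 'n list. distinct js \<and> set js = UNIV"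
    using finite_distinct_list[of "UNIV :: 'n set"] by auto
  then have "distinct (coords :: 'n list) \<and> set (coords :: 'n list) = UNIV"
    unfolding coords_def by (rule someI_ex)
  then show "distinct (coords :: 'n list)" "set (coords :: 'n list) = UNIV" by auto
qed

definition mderiv :: "'n multi_index \<Rightarrow> (real ^ 'n \<Rightarrow> complex) \<Rightarrow> real ^ 'n \<Rightarrow> complex" where
  "mderiv \<beta> = foldr (\<lambda>j D. (pderiv_at j ^^ \<beta> j) \<circ> D) coords id"

definition scaled_mderiv ::
    "complex \<Rightarrow> 'n multi_index \<Rightarrow> (real ^ 'n \<Rightarrow> complex) \<Rightarrow> real ^ 'n \<Rightarrow> complex" where
  "scaled_mderiv c \<beta> f = (\<lambda>x. c ^ mdeg \<beta> * mderiv \<beta> f x)"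

definition R_op ::
    "'n multi_index \<Rightarrow> complex \<Rightarrow> (real ^ 'n \<Rightarrow> complex) \<Rightarrow> real ^ 'n \<Rightarrow> complex" where
  "R_op \<alpha> \<omega> \<phi> = (\<lambda>x.
     \<Sum>(\<beta>, \<gamma>) \<in> {(\<beta>, \<gamma>). (\<lambda>j. \<beta> j + \<gamma> j) = \<alpha> \<and> \<beta> \<noteq> (\<lambda>_. 0)}.
     \<Sum>\<kappa> \<in> {\<kappa>. \<forall>j. 2 * \<kappa> j \<le> \<beta> j}.
       of_nat (mfact \<alpha>) / of_nat (mfact \<gamma> * mfact \<kappa> * mfact (\<lambda>j. \<beta> j - 2 * \<kappa> j))
       * \<omega> ^ mdeg \<kappa>
       * scaled_mderiv (- 2 * \<omega>) (\<lambda>j. \<beta> j - 2 * \<kappa> j) (heat \<omega> (xmult \<gamma> \<phi>)) x)"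

end

theory Submission
  imports "HOL-Probability.Distributions" "HOL-Computational_Algebra.Polynomial" Defs
begin

text \<open>Write $x^\alpha = ((x - y) + y)^\alpha$ under the convolution integral and expand by the
  multinomial formula. The function $z^\beta G_\omega(z)$ is a combination of derivatives of
  $G_\omega$: in one variable, with $u_k = z^k G_\omega$ and $D = -2 \omega \partial$, one has
  $u_{k+1} = D u_k + 2 \omega k u_{k-1}$, whose solution is
  $u_k = \sum_i \frac{k!}{i! (k-2i)!} \omega^i D^{k-2i} G_\omega$. The derivatives of $G_\omega$
  have Gaussian decay, so they may be moved out of the integral for every $L^q$ function, and by
  Young's inequality their convolutions stay in $L^q$. Hence the identity even holds pointwise; the
  summand with $\beta = 0$ is $e^{\omega \Delta} (x^\alpha \varphi)$.\<close>

text \<open>Since \<open>\<phi>\<close> need not be differentiable, every derivative has to fall on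
  the kernel. The kernels are therefore given in closed form, as polynomial times Gaussian; this
  family is closed under each partial derivative, so no symmetry of mixed derivatives enters. The
  hypothesis on \<open>Re \<omega>\<close> gives these kernels two properties that are used side by
  side: they are bounded, so that convolution with an \<open>Lq\<close> function converges at every
  point, and integrable, so that it maps \<open>Lq\<close> to itself. The factor
  \<open>- 2 * \<omega>\<close> comes from d/dz G = - z / (2 \<omega>) G, that is z G = D G. The
  number k! / (i! (k - 2i)!) \<omega>^i counts the ways to choose i disjoint unordered pairs among k
  factors, k! / (2^i i! (k - 2i)!), with a contribution 2 \<omega> from each pair. A technical
  obstacle is that \<open>Lq\<close> consists of Lebesgue measurable functions, whereas Fubini on
  products needs Borel functions; a Borel representative bridges the gap.\<close>

section \<open>The spaces $L^q$ and Young's inequality\<close>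

text \<open>Convexity of the power, derived from Young's inequality for \<open>a powr p\<close> and
  \<open>s powr p\<close> with weights \<open>1 / p\<close> and \<open>1 - 1 / p\<close>. Integrated
  against a kernel it yields Jensen's inequality in \<open>convolution_Lq\<close>.\<close>

lemma powr_tangent_le:
  fixes a s p :: real
  assumes "0 \<le> a" "0 \<le> s" "1 \<le> p"
  shows "s powr p + p * s powr (p - 1) * (a - s) \<le> a powr p"
proof (cases "s = 0 \<or> a = 0")
  case False
  then have s: "s > 0" "a > 0" using assms by auto
  have "(a powr p) powr (1/p) * (s powr p) powr (1 - 1/p) \<le> (1/p) * a powr p + (1 - 1/p) * s powr p"
    using assms s by (intro Youngs_inequality_0) auto
  moreover have "(a powr p) powr (1/p) = a"
    using assms by (simp add: powr_powr)
  moreover have "(s powr p) powr (1 - 1/p) = s powr (p - 1)"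
    using assms by (simp add: powr_powr right_diff_distrib)
  ultimately have "p * (a * s powr (p - 1)) \<le> p * ((1/p) * a powr p + (1 - 1/p) * s powr p)"
    using assms by (intro mult_left_mono) auto
  also have "\<dots> = a powr p + (p - 1) * s powr p"
    using assms by (simp add: field_simps)
  finally have "p * (a * s powr (p - 1)) \<le> a powr p + (p - 1) * s powr p" .
  moreover have "s * s powr (p - 1) = s powr p"
    using s by (simp add: powr_diff)
  then have "p * s powr (p - 1) * (a - s) = p * (a * s powr (p - 1)) - p * s powr p"
    by (metis (no_types) mult.assoc mult.commute right_diff_distrib)
  ultimately show ?thesis
    by (simp add: left_diff_distrib)
next
  \<comment> \<open>For \<open>s = 0\<close> the left side is 0, because \<open>0 powr r = 0\<close>
    even for \<open>r = 0\<close>, which occurs at \<open>p = 1\<close>. For \<open>a = 0\<close>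
    the claim amounts to \<open>s powr p \<le> p * s powr p\<close>.\<close>
  case True
  have "s powr (p - 1) * s = s powr p"
    using assms by (cases "s = 0") (simp_all add: powr_diff)
  then have "p * s powr (p - 1) * s = p * s powr p"
    by (simp add: mult.assoc)
  moreover have "1 * s powr p \<le> p * s powr p"
    using assms by (intro mult_right_mono) auto
  ultimately show ?thesis
    using True assms by (auto simp: right_diff_distrib mult.assoc)
qed

lemma Lq_top_iff:
  "f \<in> Lq top \<longleftrightarrow> f \<in> borel_measurable lebesgue \<and> (\<exists>B. AE x in lebesgue. norm (f x) \<le> B)"
proof -
  have "esssup lebesgue (\<lambda>x. ereal (norm (f x))) < \<infinity> \<longleftrightarrow> (\<exists>B. AE x in lebesgue. norm (f x) \<le> B)"
    if [measurable]: "f \<in> borel_measurable lebesgue"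
  proof
    assume "esssup lebesgue (\<lambda>x. ereal (norm (f x))) < \<infinity>"
    then obtain B where "esssup lebesgue (\<lambda>x. ereal (norm (f x))) \<le> ereal B"
      by (cases "esssup lebesgue (\<lambda>x. ereal (norm (f x)))") auto
    note B = this
    have "AE x in lebesgue. norm (f x) \<le> B"
      using esssup_AE[of "\<lambda>x. ereal (norm (f x))" lebesgue]
      by eventually_elim (use B order_trans in \<open>fastforce\<close>)
    then show "\<exists>B. AE x in lebesgue. norm (f x) \<le> B" ..
  next
    assume "\<exists>B. AE x in lebesgue. norm (f x) \<le> B"
    then obtain B where "AE x in lebesgue. norm (f x) \<le> B" ..
    then have "esssup lebesgue (\<lambda>x. ereal (norm (f x))) \<le> ereal B"
      by (intro esssup_I) auto
    then show "esssup lebesgue (\<lambda>x. ereal (norm (f x))) < \<infinity>"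
      by (rule le_less_trans) simp
  qed
  then show ?thesis by (auto simp: Lq_def)
qed

lemma Lq_finite_iff:
  assumes "q \<noteq> \<infinity>"
  shows "f \<in> Lq q \<longleftrightarrow> f \<in> borel_measurable lebesgue
    \<and> integrable lebesgue (\<lambda>x. norm (f x) powr enn2real q)"
  using assms by (auto simp: Lq_def integrable_iff_bounded)

lemma enn2real_ge_1:
  assumes "1 \<le> q" "q \<noteq> \<infinity>"
  shows "1 \<le> enn2real q"
  using assms by (cases q) (auto simp: ennreal_le_iff simp flip: ennreal_1)

lemma Lq_measurable: "f \<in> Lq q \<Longrightarrow> f \<in> borel_measurable lebesgue"
  by (simp add: Lq_def)

text \<open>The sum is at most twice the larger term, whose power is one of the two on the right.
  The crude constant suffices, as only membership in \<open>Lq\<close> is at stake.\<close>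

lemma powr_add_le:
  fixes a b p :: real
  assumes "0 \<le> a" "0 \<le> b" "0 \<le> p"
  shows "(a + b) powr p \<le> 2 powr p * (a powr p + b powr p)"
proof -
  have "(a + b) powr p \<le> (2 * max a b) powr p"
    using assms by (intro powr_mono2) auto
  also have "\<dots> = 2 powr p * max a b powr p"
    using assms by (simp add: powr_mult)
  also have "\<dots> \<le> 2 powr p * (a powr p + b powr p)"
    by (intro mult_left_mono) (auto simp: max_def)
  finally show ?thesis .
qed

lemma Lq_add:
  assumes "f \<in> Lq q" "g \<in> Lq q"
  shows "(\<lambda>x. f x + g x) \<in> Lq q"
proof (cases "q = \<infinity>")
  case True
  with assms obtain A B where "AE x in lebesgue. norm (f x) \<le> A" "AE x in lebesgue. norm (g x) \<le> B"
    by (auto simp: Lq_top_iff)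
  then have "AE x in lebesgue. norm (f x + g x) \<le> A + B"
    by eventually_elim (rule norm_triangle_mono)
  with True assms show ?thesis by (auto simp: Lq_top_iff)
next
  case False
  let ?p = "enn2real q"
  have [measurable]: "f \<in> borel_measurable lebesgue" "g \<in> borel_measurable lebesgue"
    using assms by (auto simp: Lq_measurable)
  let ?h = "\<lambda>x. 2 powr ?p * (norm (f x) powr ?p + norm (g x) powr ?p)"
  have le: "norm (f x + g x) powr ?p \<le> ?h x" for x
    by (rule order_trans[OF powr_mono2 powr_add_le]) (auto simp: norm_triangle_ineq)
  have "integrable lebesgue ?h"
    using assms False by (intro integrable_mult_right Bochner_Integration.integrable_add) (auto simp: Lq_finite_iff)
  then have "integrable lebesgue (\<lambda>x. norm (f x + g x) powr ?p)"
  proof (rule Bochner_Integration.integrable_bound)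
    show "AE x in lebesgue. norm (norm (f x + g x) powr ?p) \<le> norm (?h x)"
      using le by (intro always_eventually allI) (simp add: abs_of_nonneg)
  qed measurable
  with False show ?thesis by (simp add: Lq_finite_iff)
qed

lemma Lq_cmult:
  assumes "f \<in> Lq q"
  shows "(\<lambda>x. c * f x) \<in> Lq q"
proof (cases "q = \<infinity>")
  case True
  with assms obtain A where "AE x in lebesgue. norm (f x) \<le> A"
    by (auto simp: Lq_top_iff)
  then have "AE x in lebesgue. norm (c * f x) \<le> norm c * A"
    by eventually_elim (simp add: norm_mult mult_left_mono)
  with True assms show ?thesis by (auto simp: Lq_top_iff)
qed (use assms in \<open>auto simp: Lq_finite_iff norm_mult powr_mult\<close>)

lemma Lq_zero: "(\<lambda>x. 0) \<in> Lq q"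
  by (cases "q = \<infinity>") (auto simp: Lq_top_iff Lq_finite_iff)

lemma Lq_sum:
  assumes "\<And>i. i \<in> I \<Longrightarrow> f i \<in> Lq q"
  shows "(\<lambda>x. \<Sum>i\<in>I. f i x) \<in> Lq q"
  using assms by (induction I rule: infinite_finite_induct) (auto simp: Lq_zero intro: Lq_add)

text \<open>The Gaussian factors over the orthonormal \<open>Basis\<close>, so its integral is a
  product of one-variable integrals, each of them a multiple of the mass of a normal
  density.\<close>

lemma integrable_gaussian:
  assumes "a > 0"
  shows "integrable lborel (\<lambda>x :: 'a::euclidean_space. exp (- a * (norm x)\<^sup>2))"
proof -
  have 1: "(\<integral>\<^sup>+t. ennreal (exp (- a * t\<^sup>2)) \<partial>lborel) < \<infinity>"
  proof -
    \<comment> \<open>The standard deviation for which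
      \<open>1 / (2 * s\<^sup>2) = a\<close>.\<close>
    define s where "s = sqrt (1 / (2 * a))"
    have s: "s > 0" "2 * s\<^sup>2 = 1 / a" using assms by (auto simp: s_def)
    have "integrable lborel (\<lambda>t. sqrt (2 * pi * s\<^sup>2) * normal_density 0 s t)"
      using s by simp
    also have "(\<lambda>t. sqrt (2 * pi * s\<^sup>2) * normal_density 0 s t) = (\<lambda>t. exp (- a * t\<^sup>2))"
      using s assms by (auto simp: normal_density_def fun_eq_iff)
    finally show ?thesis by (simp add: integrable_iff_bounded)
  qed
  have "exp (- a * (norm x)\<^sup>2) = (\<Prod>b\<in>Basis. exp (- a * (x \<bullet> b)\<^sup>2))" for x :: 'a
    unfolding power2_norm_eq_inner euclidean_inner[of x x]
    by (simp add: power2_eq_square sum_distrib_left sum_negf flip: exp_sum)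
  then have "(\<integral>\<^sup>+x. ennreal (exp (- a * (norm (x::'a))\<^sup>2)) \<partial>lborel)
      = (\<integral>\<^sup>+x. (\<Prod>b\<in>Basis. ennreal (exp (- a * ((x::'a) \<bullet> b)\<^sup>2))) \<partial>lborel)"
    by (simp add: prod_ennreal)
  also have "\<dots> = (\<Prod>b\<in>(Basis::'a set). \<integral>\<^sup>+t. ennreal (exp (- a * t\<^sup>2)) \<partial>lborel)"
    by (subst nn_integral_lborel_prod) auto
  also have "\<dots> < \<infinity>"
    using 1 by (simp add: ennreal_prod_eq_top less_top power_less_top_ennreal)
  finally show ?thesis
    by (simp add: integrable_iff_bounded)
qed

lemma integrable_lborel_reflect:
  fixes f :: "'a::euclidean_space \<Rightarrow> 'b::{banach, second_countable_topology}"
  assumes "integrable lborel f"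
  shows "integrable lborel (\<lambda>y. f (x - y))"
proof -
  have eq: "lborel = distr lborel borel (\<lambda>y. x + (- 1) *\<^sub>R y :: 'a)"
    using lborel_affine[of "-1" x] by (simp add: density_1)
  have "f \<in> borel_measurable borel" using assms by auto
  then show ?thesis
    using assms by (subst (asm) eq, subst (asm) integrable_distr_eq) auto
qed

text \<open>Hoelder's inequality is avoided by the bound $|\psi| \le 1 + |\psi|^q$.\<close>

lemma integrable_mult_Lq:
  fixes K :: "real ^ 'n \<Rightarrow> complex"
  assumes q: "1 \<le> q" and \<psi>: "\<psi> \<in> Lq q"
    and K: "integrable lborel K" and B: "\<And>z. norm (K z) \<le> B"
  shows "integrable lebesgue (\<lambda>y. K y * \<psi> y)"
proof -
  have [measurable]: "\<psi> \<in> borel_measurable lebesgue"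
    using \<psi> by (rule Lq_measurable)
  have [measurable]: "K \<in> borel_measurable lebesgue"
    using K by (auto intro: measurable_completion)
  have intK: "integrable lebesgue (\<lambda>y. norm (K y))"
    using K by (simp add: integrable_completion)
  show ?thesis
  proof (cases "q = \<infinity>")
    case True
    with \<psi> obtain A where A: "AE y in lebesgue. norm (\<psi> y) \<le> A"
      by (auto simp: Lq_top_iff)
    have "integrable lebesgue (\<lambda>y. norm (K y) * A)"
      using intK by (rule integrable_mult_left)
    then show ?thesis
    proof (rule Bochner_Integration.integrable_bound)
      show "AE y in lebesgue. norm (K y * \<psi> y) \<le> norm (norm (K y) * A)"
        using A by eventually_elim (auto simp: norm_mult intro!: order_trans[OF mult_left_mono abs_ge_self])
    qed measurable
  next
    case False
    let ?p = "enn2real q"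
    have p: "1 \<le> ?p" using enn2real_ge_1[OF q False] .
    \<comment> \<open>In the product of \<open>norm (K y)\<close> with
      \<open>1 + norm (\<psi> y) powr ?p\<close>, integrability of \<open>K\<close> pays for the 1
      and the bound \<open>B\<close> for the power.\<close>
    have "integrable lebesgue (\<lambda>y. norm (K y) + B * norm (\<psi> y) powr ?p)"
      using \<psi> False intK by (auto simp: Lq_finite_iff intro!: Bochner_Integration.integrable_add)
    then show ?thesis
    proof (rule Bochner_Integration.integrable_bound)
      have "norm (K y * \<psi> y) \<le> norm (norm (K y) + B * norm (\<psi> y) powr ?p)" for y
      proof -
        have "norm (\<psi> y) \<le> 1 + norm (\<psi> y) powr ?p"
          using powr_mono[of 1 ?p "norm (\<psi> y)"] p by (cases "norm (\<psi> y) \<le> 1") (auto simp: add_increasing2)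
        then have "norm (K y * \<psi> y) \<le> norm (K y) * (1 + norm (\<psi> y) powr ?p)"
          by (simp add: norm_mult mult_left_mono)
        also have "\<dots> \<le> norm (K y) + B * norm (\<psi> y) powr ?p"
          using B[of y] by (simp add: distrib_left mult_right_mono)
        finally show ?thesis by simp
      qed
      then show "AE y in lebesgue. norm (K y * \<psi> y) \<le> norm (norm (K y) + B * norm (\<psi> y) powr ?p)"
        by (intro always_eventually allI)
    qed measurable
  qed
qed

text \<open>Real and imaginary part are treated separately. This supplies the Borel representative
  that Fubini requires.\<close>

lemma completion_ex_borel_measurable_complex:
  fixes g :: "'a \<Rightarrow> complex"
  assumes "g \<in> borel_measurable (completion M)"
  shows "\<exists>g'\<in>borel_measurable M. AE x in M. g x = g' x"
proof -
  have "(\<lambda>x. Re (g x)) \<in> borel_measurable (completion M)"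
       "(\<lambda>x. Im (g x)) \<in> borel_measurable (completion M)"
    using assms by measurable
  then obtain u v where [measurable]: "u \<in> borel_measurable M" "v \<in> borel_measurable M"
    and "AE x in M. Re (g x) = u x" "AE x in M. Im (g x) = v x"
    using completion_ex_borel_measurable_real by metis
  then have "AE x in M. g x = Complex (u x) (v x)"
    by (auto elim!: eventually_elim2 simp: complex_eq_iff)
  moreover have "(\<lambda>x. Complex (u x) (v x)) \<in> borel_measurable M"
    unfolding Complex_eq by measurable
  ultimately show ?thesis by (rule rev_bexI[rotated])
qed

lemma nn_integral_lborel_translate:
  fixes f :: "'a::euclidean_space \<Rightarrow> ennreal"
  assumes [measurable]: "f \<in> borel_measurable borel"
  shows "(\<integral>\<^sup>+x. f (x - y) \<partial>lborel) = (\<integral>\<^sup>+x. f x \<partial>lborel)"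
proof -
  have "(\<integral>\<^sup>+x. f x \<partial>lborel) = (\<integral>\<^sup>+x. f x \<partial>distr lborel borel ((+) (- y)))"
    by (simp only: lborel_distr_plus)
  also have "\<dots> = (\<integral>\<^sup>+x. f (x - y) \<partial>lborel)"
    by (subst nn_integral_distr) auto
  finally show ?thesis ..
qed

text \<open>Qualitative form of Young's inequality. For finite \<open>q\<close>, Jensen's inequality
  with respect to the density \<open>norm (K (x - y))\<close> bounds the power of the convolution
  pointwise, and Tonelli integrates this bound. The bound \<open>B\<close> makes the integrals
  converge for every \<open>x\<close>, so Jensen applies at each point.\<close>

lemma convolution_Lq:
  fixes K :: "real ^ 'n \<Rightarrow> complex"
  assumes q: "1 \<le> q" and \<psi>: "\<psi> \<in> Lq q"
    and K: "integrable lborel K" and B: "\<And>z. norm (K z) \<le> B"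
  shows "convolution K \<psi> \<in> Lq q"
proof -
  \<comment> \<open>Changing \<open>\<psi>\<close> on a null set alters no value of the convolution,
    and with \<open>\<psi>'\<close> the integrand is jointly Borel in \<open>x\<close> and
    \<open>y\<close>.\<close>
  obtain \<psi>' where [measurable]: "\<psi>' \<in> borel_measurable borel" and eq: "AE y in lborel. \<psi> y = \<psi>' y"
    using completion_ex_borel_measurable_complex[OF Lq_measurable[OF \<psi>]] by auto
  have [measurable]: "K \<in> borel_measurable borel"
    using K by auto
  have [measurable]: "\<psi>' \<in> borel_measurable lebesgue" "K \<in> borel_measurable lebesgue"
    by (auto intro: measurable_completion)
  have mc [measurable]: "(\<lambda>y. K (x - y)) \<in> borel_measurable borel" for x
    by measurable
  have mc' [measurable]: "(\<lambda>y. K (x - y)) \<in> borel_measurable lebesgue" for x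
    using mc[of x] by (auto intro: measurable_completion)
  have eq': "AE y in lebesgue. \<psi> y = \<psi>' y"
    using eq by (rule AE_completion)
  have conv: "convolution K \<psi> = (\<lambda>x. \<integral>y. K (x - y) * \<psi>' y \<partial>lborel)"
  proof
    fix x
    have "convolution K \<psi> x = (\<integral>y. K (x - y) * \<psi>' y \<partial>lebesgue)"
      unfolding convolution_def using eq' Lq_measurable[OF \<psi>]
      by (intro integral_cong_AE) (auto elim: eventually_mono)
    also have "\<dots> = (\<integral>y. K (x - y) * \<psi>' y \<partial>lborel)"
      by (intro integral_completion) measurable
    finally show "convolution K \<psi> x = (\<integral>y. K (x - y) * \<psi>' y \<partial>lborel)" .
  qed
  have [measurable]: "convolution K \<psi> \<in> borel_measurable borel"
    unfolding conv by measurable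
  have meas: "convolution K \<psi> \<in> borel_measurable lebesgue"
    by (auto intro: measurable_completion)
  have Kx: "integrable lborel (\<lambda>y. norm (K (x - y)))" for x
    using integrable_lborel_reflect[OF K] by (rule integrable_norm)
  have int_x: "integrable lborel (\<lambda>y. K (x - y) * \<psi>' y)" for x
  proof -
    have "integrable lebesgue (\<lambda>y. K (x - y) * \<psi> y)"
      by (rule integrable_mult_Lq[OF q \<psi> integrable_lborel_reflect[OF K] B])
    then have "integrable lebesgue (\<lambda>y. K (x - y) * \<psi>' y)"
      using eq' Lq_measurable[OF \<psi>]
      by (subst (asm) integrable_cong_AE) (auto elim: eventually_mono)
    then show ?thesis
      by (subst (asm) integrable_completion) auto
  qed
  define c where "c = (\<integral>y. norm (K y) \<partial>lborel)"
  have c0: "0 \<le> c" by (simp add: c_def)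
  have nnc: "(\<integral>\<^sup>+y. ennreal (norm (K y)) \<partial>lborel) = ennreal c"
    using K by (simp add: c_def nn_integral_eq_integral)
  have ccr: "(\<integral>y. norm (K (x - y)) \<partial>lborel) = c" for x
  proof -
    have eqm: "lborel = distr lborel borel (\<lambda>y. x + (- 1) *\<^sub>R y)"
      using lborel_affine[of "-1" x] by (simp add: density_1)
    show ?thesis
      unfolding c_def by (subst (2) eqm, subst integral_distr) auto
  qed
  show ?thesis
  proof (cases "q = \<infinity>")
    case True
    with \<psi> obtain A where "AE y in lebesgue. norm (\<psi> y) \<le> A"
      by (auto simp: Lq_top_iff)
    with eq' have "AE y in lebesgue. norm (\<psi>' y) \<le> A"
      by eventually_elim simp
    then have A: "AE y in lborel. norm (\<psi>' y) \<le> A"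
      by (simp add: AE_completion_iff)
    have "norm (convolution K \<psi> x) \<le> c * A" for x
    proof -
      have "norm (convolution K \<psi> x) \<le> (\<integral>y. norm (K (x - y)) * A \<partial>lborel)"
        unfolding conv
      proof (rule order_trans[OF integral_norm_bound integral_mono_AE])
        show "integrable lborel (\<lambda>y. norm (K (x - y) * \<psi>' y))"
          using int_x by (rule integrable_norm)
        show "integrable lborel (\<lambda>y. norm (K (x - y)) * A)"
          using Kx by (rule integrable_mult_left)
        show "AE y in lborel. norm (K (x - y) * \<psi>' y) \<le> norm (K (x - y)) * A"
          using A by eventually_elim (auto simp: norm_mult intro!: mult_left_mono)
      qed
      then show ?thesis by (simp add: ccr)
    qed
    with meas True show ?thesis by (auto simp: Lq_top_iff)
  next
    case False
    let ?p = "enn2real q"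
    have p: "1 \<le> ?p" using enn2real_ge_1[OF q False] .
    have "integrable lebesgue (\<lambda>y. norm (\<psi> y) powr ?p)"
      using \<psi> False by (simp add: Lq_finite_iff)
    then have "integrable lebesgue (\<lambda>y. norm (\<psi>' y) powr ?p)"
      using eq' Lq_measurable[OF \<psi>] by (subst integrable_cong_AE) (auto elim: eventually_mono)
    then have int_p: "integrable lborel (\<lambda>y. norm (\<psi>' y) powr ?p)"
      by (subst (asm) integrable_completion) auto
    have pt: "norm (convolution K \<psi> x) powr ?p
      \<le> (c + 1) powr ?p * (\<integral>y. norm (K (x - y)) * norm (\<psi>' y) powr ?p \<partial>lborel)"
      and int_k: "integrable lborel (\<lambda>y. norm (K (x - y)) * norm (\<psi>' y) powr ?p)" for x
    proof -
      let ?k = "\<lambda>y. norm (K (x - y))"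
      show int_k: "integrable lborel (\<lambda>y. ?k y * norm (\<psi>' y) powr ?p)"
      proof (rule Bochner_Integration.integrable_bound)
        show "integrable lborel (\<lambda>y. B * norm (\<psi>' y) powr ?p)"
          using int_p by (rule integrable_mult_right)
        show "AE y in lborel. norm (?k y * norm (\<psi>' y) powr ?p) \<le> norm (B * norm (\<psi>' y) powr ?p)"
          using B order_trans[OF norm_ge_zero B] by (auto intro!: always_eventually mult_right_mono simp: abs_mult)
      qed measurable
      have int1: "integrable lborel (\<lambda>y. ?k y * norm (\<psi>' y))"
        using integrable_norm[OF int_x[of x]] by (simp add: norm_mult)
      \<comment> \<open>Jensen's inequality via the tangent to $t^p$ at $s$; taking $c + 1$ instead of the total
        mass $c$ of the kernel in $s$ loses only a constant and covers $c = 0$.\<close>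
      define S where "S = (\<integral>y. ?k y * norm (\<psi>' y) \<partial>lborel)"
      define s where "s = S / (c + 1)"
      have S0: "0 \<le> S" unfolding S_def by simp
      then have s0: "0 \<le> s" using c0 by (simp add: s_def)
      have "norm (convolution K \<psi> x) \<le> S"
        unfolding conv S_def by (rule order_trans[OF integral_norm_bound]) (simp add: norm_mult)
      then have "norm (convolution K \<psi> x) powr ?p \<le> S powr ?p"
        using p by (intro powr_mono2) auto
      also have "\<dots> = (c + 1) powr ?p * s powr ?p"
        using c0 S0 by (simp add: s_def flip: powr_mult)
      also have "\<dots> \<le> (c + 1) powr ?p * (\<integral>y. ?k y * norm (\<psi>' y) powr ?p \<partial>lborel)"
      proof (rule mult_left_mono)
        let ?t = "\<lambda>y. ?k y * (s powr ?p - ?p * s powr (?p - 1) * s) + (?k y * norm (\<psi>' y)) * (?p * s powr (?p - 1))"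
        have "s powr (?p - 1) * s = s powr ?p"
          using s0 by (cases "s = 0") (simp_all add: powr_diff)
        then have sp: "?p * s powr (?p - 1) * s = ?p * s powr ?p"
          by (simp add: mult.assoc)
        have S_eq: "S = s * (c + 1)" using c0 by (simp add: s_def)
        \<comment> \<open>The integral of the tangent line is exactly
          \<open>s powr ?p * (c + ?p)\<close>, since the mass is \<open>c\<close> while
          \<open>S = s * (c + 1)\<close>. The factor is at least 1 because \<open>?p\<close>
          is.\<close>
        have "s powr ?p \<le> s powr ?p * (c + ?p)"
          using p c0 mult_left_mono[of 1 "c + ?p" "s powr ?p"] by simp
        also have "\<dots> = c * (s powr ?p - ?p * s powr (?p - 1) * s) + S * (?p * s powr (?p - 1))"
        proof -
          have "S * (?p * s powr (?p - 1)) = (c + 1) * (?p * s powr (?p - 1) * s)"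
            unfolding S_eq by (simp only: mult_ac)
          then show ?thesis
            unfolding sp by (simp add: algebra_simps)
        qed
        also have "\<dots> = (\<integral>y. ?t y \<partial>lborel)"
          using int1 Kx by (simp add: ccr S_def)
        also have "\<dots> \<le> (\<integral>y. ?k y * norm (\<psi>' y) powr ?p \<partial>lborel)"
        proof (rule integral_mono[OF _ int_k])
          show "integrable lborel ?t"
            using int1 Kx by (intro Bochner_Integration.integrable_add integrable_mult_left) auto
          show "?t y \<le> ?k y * norm (\<psi>' y) powr ?p" for y
            using mult_left_mono[OF powr_tangent_le[OF norm_ge_zero s0 p, of "\<psi>' y"] norm_ge_zero[of "K (x - y)"]]
            by (simp add: algebra_simps)
        qed
        finally show "s powr ?p \<le> (\<integral>y. ?k y * norm (\<psi>' y) powr ?p \<partial>lborel)" .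
      qed simp
      finally show "norm (convolution K \<psi> x) powr ?p
        \<le> (c + 1) powr ?p * (\<integral>y. ?k y * norm (\<psi>' y) powr ?p \<partial>lborel)" .
    qed
    let ?f = "\<lambda>x y. ennreal (norm (K (x - y)) * norm (\<psi>' y) powr ?p)"
    have "(\<integral>\<^sup>+x. ennreal (norm (convolution K \<psi> x) powr ?p) \<partial>lborel)
      \<le> (\<integral>\<^sup>+x. ennreal ((c + 1) powr ?p) * (\<integral>\<^sup>+y. ?f x y \<partial>lborel) \<partial>lborel)"
    proof (rule nn_integral_mono)
      fix x
      have "(\<integral>\<^sup>+y. ?f x y \<partial>lborel) = ennreal (\<integral>y. norm (K (x - y)) * norm (\<psi>' y) powr ?p \<partial>lborel)"
        by (intro nn_integral_eq_integral int_k) auto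
      then show "ennreal (norm (convolution K \<psi> x) powr ?p)
          \<le> ennreal ((c + 1) powr ?p) * (\<integral>\<^sup>+y. ?f x y \<partial>lborel)"
        using pt[of x] by (simp add: ennreal_leI flip: ennreal_mult)
    qed
    also have "\<dots> = ennreal ((c + 1) powr ?p) * (\<integral>\<^sup>+x. (\<integral>\<^sup>+y. ?f x y \<partial>lborel) \<partial>lborel)"
      by (rule nn_integral_cmult) measurable
    \<comment> \<open>After the exchange, translation invariance turns the inner integral into the
      mass \<open>c\<close> times a power of \<open>norm (\<psi>' y)\<close>.\<close>
    also have "(\<integral>\<^sup>+x. (\<integral>\<^sup>+y. ?f x y \<partial>lborel) \<partial>lborel) = (\<integral>\<^sup>+y. (\<integral>\<^sup>+x. ?f x y \<partial>lborel) \<partial>lborel)"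
      by (rule lborel_pair.Fubini') measurable
    also have "(\<lambda>y. \<integral>\<^sup>+x. ?f x y \<partial>lborel) = (\<lambda>y. ennreal c * ennreal (norm (\<psi>' y) powr ?p))"
    proof
      fix y
      have "(\<integral>\<^sup>+x. ?f x y \<partial>lborel) = (\<integral>\<^sup>+x. ennreal (norm (K (x - y))) \<partial>lborel) * ennreal (norm (\<psi>' y) powr ?p)"
        by (simp add: ennreal_mult nn_integral_multc)
      also have "(\<integral>\<^sup>+x. ennreal (norm (K (x - y))) \<partial>lborel) = ennreal c"
        unfolding nnc[symmetric] by (rule nn_integral_lborel_translate) measurable
      finally show "(\<integral>\<^sup>+x. ?f x y \<partial>lborel) = ennreal c * ennreal (norm (\<psi>' y) powr ?p)" .
    qed
    also have "ennreal ((c + 1) powr ?p) * (\<integral>\<^sup>+y. ennreal c * ennreal (norm (\<psi>' y) powr ?p) \<partial>lborel) < \<infinity>"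
      using int_p by (auto simp: nn_integral_cmult integrable_iff_bounded ennreal_mult_less_top)
    finally have "(\<integral>\<^sup>+x. ennreal (norm (convolution K \<psi> x) powr ?p) \<partial>lebesgue) < \<infinity>"
      by (simp add: nn_integral_completion)
    with meas False show ?thesis by (simp add: Lq_def)
  qed
qed

section \<open>Derivatives of the heat semigroup\<close>

text \<open>Differentiation under the integral: the normalised remainder \<open>r h\<close> tends to
  0 pointwise and is dominated by \<open>2 * g\<close>, so its integral tends to 0. The limit is
  taken along sequences to fit dominated convergence.\<close>

lemma has_vector_derivative_lebesgue_integral:
  fixes f :: "real \<Rightarrow> 'a \<Rightarrow> 'b::{banach, second_countable_topology}"
  assumes int: "\<And>t. integrable M (f t)"
    and der: "\<And>t y. ((\<lambda>s. f s y) has_vector_derivative f' t y) (at t)"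
    and meas [measurable]: "f' 0 \<in> borel_measurable M"
    and g: "integrable M g"
    and bound: "\<And>t y. \<bar>t\<bar> \<le> 1 \<Longrightarrow> norm (f' t y) \<le> g y"
  shows "((\<lambda>t. \<integral>y. f t y \<partial>M) has_vector_derivative (\<integral>y. f' 0 y \<partial>M)) (at 0)"
proof -
  let ?S = "{-1<..<1::real}"
  define r where "r h y = (f h y - f 0 y - h *\<^sub>R f' 0 y) /\<^sub>R norm h" for h y
  have [measurable]: "f t \<in> borel_measurable M" for t using int by auto
  have intD: "integrable M (f' 0)"
    using g by (rule Bochner_Integration.integrable_bound)
      (auto intro!: always_eventually order_trans[OF bound abs_ge_self])
  have r_lim: "((\<lambda>h. r h y) \<longlongrightarrow> 0) (at 0 within ?S)" for y
    using has_vector_derivative_at_within[OF der[where t=0 and y=y], of ?S]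
    by (simp add: has_vector_derivative_def has_derivative_at_within r_def)
  have r_bound: "norm (r h y) \<le> 2 * g y" if h: "h \<in> ?S - {0}" for h y
  proof -
    \<comment> \<open>Mean value inequality for the function minus its linearization, whose
      derivative \<open>f' s y - f' 0 y\<close> is bounded by \<open>2 * g y\<close>.\<close>
    have "norm (f h y - f 0 y - (h - 0) *\<^sub>R f' 0 y) \<le> norm (h - 0) * (2 * g y)"
    proof (rule vector_differentiable_bound_linearization[where f="\<lambda>s. f s y" and f'="\<lambda>s. f' s y" and S="?S"])
      show "closed_segment 0 h \<subseteq> ?S"
        using h by (intro closed_segment_subset) auto
      show "norm (f' s y - f' 0 y) \<le> 2 * g y" if "s \<in> ?S" for s
      proof -
        have "norm (f' s y) \<le> g y" "norm (f' 0 y) \<le> g y"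
          using that by (auto intro: bound)
        then show ?thesis
          using norm_triangle_ineq4[of "f' s y" "f' 0 y"] by linarith
      qed
    qed (auto intro: has_vector_derivative_at_within der)
    then show ?thesis
      using h by (simp add: r_def divide_simps mult.commute)
  qed
  have "((\<lambda>h. \<integral>y. r h y \<partial>M) \<longlongrightarrow> 0) (at 0 within ?S)"
    unfolding tendsto_at_iff_sequentially comp_def
  proof (intro allI impI)
    fix X :: "nat \<Rightarrow> real" assume X: "\<forall>i. X i \<in> ?S - {0}" and lim: "X \<longlonglongrightarrow> 0"
    have "(\<lambda>i. \<integral>y. r (X i) y \<partial>M) \<longlonglongrightarrow> (\<integral>y. 0 \<partial>M)"
    proof (rule integral_dominated_convergence[where w="\<lambda>y. 2 * g y"])
      show "AE y in M. (\<lambda>i. r (X i) y) \<longlonglongrightarrow> 0"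
        using r_lim X lim unfolding tendsto_at_iff_sequentially comp_def by auto
      show "AE y in M. norm (r (X i) y) \<le> 2 * g y" for i
        using r_bound X by auto
      show "integrable M (\<lambda>y. 2 * g y)"
        using g by simp
    qed (auto simp: r_def)
    then show "(\<lambda>i. \<integral>y. r (X i) y \<partial>M) \<longlonglongrightarrow> 0" by simp
  qed
  moreover have "(\<integral>y. r h y \<partial>M) = ((\<integral>y. f h y \<partial>M) - (\<integral>y. f 0 y \<partial>M) - h *\<^sub>R (\<integral>y. f' 0 y \<partial>M)) /\<^sub>R norm h" for h
    unfolding r_def using int intD by simp
  ultimately have "((\<lambda>t. \<integral>y. f t y \<partial>M) has_vector_derivative (\<integral>y. f' 0 y \<partial>M)) (at 0 within ?S)"
    by (simp add: has_vector_derivative_def has_derivative_at_within bounded_linear_scaleR_left)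
  then show ?thesis
    using has_vector_derivative_within_open[of 0 ?S] by auto
qed

text \<open>The $k$-th derivative of $\exp(-t^2/(4\omega))$ is \<open>gauss_poly \<omega> k\<close> times the function.\<close>

fun gauss_poly :: "complex \<Rightarrow> nat \<Rightarrow> complex poly" where
  "gauss_poly \<omega> 0 = 1"
| "gauss_poly \<omega> (Suc k) = pderiv (gauss_poly \<omega> k) - smult (1 / (2 * \<omega>)) (pCons 0 (gauss_poly \<omega> k))"

text \<open>The partial derivative of order \<open>\<delta>\<close> of the kernel: the exponent is a
  sum over the coordinates, so each coordinate contributes its own one-variable polynomial
  factor.\<close>

definition gauss_deriv :: "complex \<Rightarrow> 'n multi_index \<Rightarrow> real ^ 'n \<Rightarrow> complex" where
  "gauss_deriv \<omega> \<delta> z = gauss_kernel \<omega> z * (\<Prod>j\<in>UNIV. poly (gauss_poly \<omega> (\<delta> j)) (of_real (z $ j)))"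

lemma gauss_deriv_0: "gauss_deriv \<omega> (\<lambda>_. 0) = gauss_kernel \<omega>"
  by (simp add: gauss_deriv_def fun_eq_iff)

lemma norm_vec_sum_squares: "(norm (z :: real ^ 'n))\<^sup>2 = (\<Sum>j\<in>UNIV. (z $ j)\<^sup>2)"
  unfolding power2_norm_eq_inner by (simp only: inner_vec_def power2_eq_square inner_real_def)

text \<open>Along the line in direction \<open>j\<close> the function is the restriction to real
  \<open>t\<close> of an entire function \<open>?F\<close>, the other coordinates entering through
  the constants \<open>N\<close> and \<open>P\<close>. Complex differentiation of \<open>?F\<close>
  reproduces the recursion of \<open>gauss_poly\<close>. All \<open>t\<close> are covered because
  differentiation under the integral needs a whole interval.\<close>

lemma has_vector_derivative_gauss_deriv:
  fixes z :: "real ^ 'n"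
  assumes "\<omega> \<noteq> 0"
  shows "((\<lambda>t. gauss_deriv \<omega> \<delta> (z + t *\<^sub>R axis j 1)) has_vector_derivative
    gauss_deriv \<omega> (\<delta>(j := Suc (\<delta> j))) (z + t *\<^sub>R axis j 1)) (at t)"
proof -
  define c where "c = (4 * of_real pi * \<omega>) powr (- (of_nat CARD('n) / 2))"
  define N where "N = complex_of_real ((norm z)\<^sup>2)"
  define P where "P = (\<Prod>i\<in>UNIV - {j}. poly (gauss_poly \<omega> (\<delta> i)) (complex_of_real (z $ i)))"
  define u where "u = complex_of_real (z $ j)"
  define E where "E s = c * exp (- (N + 2 * s * u + s\<^sup>2) / (4 * \<omega>))" for s
  have eq: "gauss_deriv \<omega> (\<delta>(j := k)) (z + t *\<^sub>R axis j 1)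
      = E (of_real t) * poly (gauss_poly \<omega> k) (u + of_real t) * P" for k t
  proof -
    have "(norm (z + t *\<^sub>R axis j 1))\<^sup>2 = (norm z)\<^sup>2 + 2 * t * (z $ j) + t\<^sup>2"
      unfolding power2_norm_eq_inner
      by (simp add: inner_add_left inner_add_right inner_axis inner_commute[of "axis j 1"]
          power2_eq_square algebra_simps)
    then have "gauss_kernel \<omega> (z + t *\<^sub>R axis j 1) = E (of_real t)"
      by (simp add: gauss_kernel_def E_def c_def N_def u_def)
    moreover have "(\<Prod>i\<in>UNIV. poly (gauss_poly \<omega> ((\<delta>(j := k)) i)) (of_real ((z + t *\<^sub>R axis j 1) $ i)))
      = poly (gauss_poly \<omega> k) (u + of_real t) * P"
      by (subst prod.remove[of _ j]) (auto simp: P_def u_def axis_def intro!: prod.cong)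
    ultimately show ?thesis
      by (simp add: gauss_deriv_def)
  qed
  let ?F = "\<lambda>s. E s * poly (gauss_poly \<omega> (\<delta> j)) (u + s) * P"
  have "(?F has_field_derivative E s * poly (gauss_poly \<omega> (Suc (\<delta> j))) (u + s) * P) (at s)" for s
    unfolding E_def using assms
    by (auto intro!: derivative_eq_intros DERIV_chain2[OF poly_DERIV] simp: field_simps)
  then have "(?F \<circ> of_real has_vector_derivative
      1 * (E (of_real t) * poly (gauss_poly \<omega> (Suc (\<delta> j))) (u + of_real t) * P)) (at t)"
    using has_vector_derivative_of_real[OF DERIV_ident, of "at t"] by (intro field_vector_diff_chain_at) simp_all
  moreover have "(\<lambda>t. gauss_deriv \<omega> \<delta> (z + t *\<^sub>R axis j 1)) = ?F \<circ> of_real"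
    using eq[of "\<delta> j"] by (simp add: fun_eq_iff)
  ultimately show ?thesis
    by (simp only: eq mult_1_left)
qed

text \<open>Each further coefficient costs a factor \<open>t\<close>, which is absorbed by half of
  the exponent; hence the induction is over all \<open>a\<close>.\<close>

lemma poly_bounded_by_gaussian:
  fixes p :: "complex poly"
  assumes "a > 0"
  shows "\<exists>C\<ge>0. \<forall>t::real. norm (poly p (of_real t)) \<le> C * exp (a * t\<^sup>2)"
  using assms
proof (induction p arbitrary: a)
  case 0
  then show ?case by (intro exI[of _ 0]) auto
next
  case (pCons b p)
  obtain C where C: "C \<ge> 0" "\<And>t::real. norm (poly p (of_real t)) \<le> C * exp (a / 2 * t\<^sup>2)"
    using pCons.IH[of "a / 2"] pCons.prems by auto
  \<comment> \<open>Chosen so that \<open>1 + t\<^sup>2 \<le> D * (1 + a / 2 * t\<^sup>2)\<close>,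
    after which 1 + x \<le> exp x applies.\<close>
  define D where "D = 1 + 2 / a"
  have D: "\<bar>t\<bar> \<le> D * exp (a / 2 * t\<^sup>2)" for t
  proof -
    have "\<bar>t\<bar> \<le> 1 + t\<^sup>2"
      using zero_le_power2[of "\<bar>t\<bar> - 1"] by (simp add: power2_diff)
    also have "\<dots> \<le> D * (1 + a / 2 * t\<^sup>2)"
      using pCons.prems by (simp add: D_def field_simps)
    also have "\<dots> \<le> D * exp (a / 2 * t\<^sup>2)"
      using pCons.prems by (intro mult_left_mono) (auto simp: D_def)
    finally show ?thesis .
  qed
  have "norm (poly (pCons b p) (of_real t)) \<le> (norm b + D * C) * exp (a * t\<^sup>2)" for t :: real
  proof -
    have "norm (poly (pCons b p) (of_real t)) \<le> norm b + \<bar>t\<bar> * norm (poly p (of_real t))"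
      by (auto intro!: order_trans[OF norm_triangle_ineq] simp: norm_mult)
    also have "\<dots> \<le> norm b * exp (a * t\<^sup>2) + (D * exp (a / 2 * t\<^sup>2)) * (C * exp (a / 2 * t\<^sup>2))"
      using D[of t] C pCons.prems
      by (intro add_mono mult_mono) (auto simp: D_def mult_le_cancel_left1)
    also have "\<dots> = (norm b + D * C) * exp (a * t\<^sup>2)"
      by (simp add: algebra_simps flip: exp_add)
    finally show ?thesis .
  qed
  moreover have "0 \<le> norm b + D * C"
    using C pCons.prems by (simp add: D_def)
  ultimately show ?case by blast
qed

lemma gauss_deriv_bound:
  assumes "Re \<omega> > 0"
  obtains C a where "C \<ge> 0" "a > 0"
    "\<And>z :: real ^ 'n. norm (gauss_deriv \<omega> \<delta> z) \<le> C * exp (- a * (norm z)\<^sup>2)"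
proof -
  \<comment> \<open>Half the decay rate of the kernel: its modulus decays at rate
    \<open>2 * a\<close>, and the polynomial factors consume \<open>a\<close>.\<close>
  define a where "a = Re (1 / (4 * \<omega>)) / 2"
  have a: "a > 0"
    using assms by (auto simp: a_def Re_divide intro!: divide_pos_pos add_pos_nonneg)
  obtain C where C: "\<And>j. 0 \<le> C j"
    "\<And>j t. norm (poly (gauss_poly \<omega> (\<delta> j)) (of_real t)) \<le> C j * exp (a * t\<^sup>2)"
    using choice[OF allI[OF poly_bounded_by_gaussian[OF a]], of "\<lambda>j. gauss_poly \<omega> (\<delta> j)"] by auto
  define c where "c = norm ((4 * of_real pi * \<omega>) powr (- (of_nat CARD('n) / 2)))"
  have "norm (gauss_deriv \<omega> \<delta> z) \<le> (c * prod C UNIV) * exp (- a * (norm z)\<^sup>2)" for z :: "real ^ 'n"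
  proof -
    have *: "norm (gauss_kernel \<omega> z) = c * exp (- (2 * a) * (norm z)\<^sup>2)"
    proof -
      have "- complex_of_real ((norm z)\<^sup>2) / (4 * \<omega>) = of_real (- (norm z)\<^sup>2) * (1 / (4 * \<omega>))"
        by simp
      then have "Re (- complex_of_real ((norm z)\<^sup>2) / (4 * \<omega>)) = - (2 * a) * (norm z)\<^sup>2"
        by (simp only: Re_complex_of_real times_complex.sel Im_complex_of_real a_def) simp
      then show ?thesis
        by (simp add: gauss_kernel_def norm_mult c_def)
    qed
    have "norm (gauss_deriv \<omega> \<delta> z) \<le> (c * exp (- (2 * a) * (norm z)\<^sup>2)) * (\<Prod>j\<in>UNIV. C j * exp (a * (z $ j)\<^sup>2))"
      unfolding gauss_deriv_def norm_mult * prod_norm[symmetric]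
      by (intro mult_left_mono prod_mono) (auto simp: C c_def)
    also have "(\<Prod>j\<in>UNIV. C j * exp (a * (z $ j)\<^sup>2)) = prod C UNIV * exp (a * (norm z)\<^sup>2)"
      by (simp add: prod.distrib norm_vec_sum_squares sum_distrib_left exp_sum)
    also have "(c * exp (- (2 * a) * (norm z)\<^sup>2)) * \<dots> = (c * prod C UNIV) * exp (- a * (norm z)\<^sup>2)"
      by (simp add: algebra_simps flip: exp_add)
    finally show ?thesis .
  qed
  moreover have "0 \<le> c * prod C UNIV"
    by (simp add: c_def C prod_nonneg)
  ultimately show ?thesis
    using a that by blast
qed

lemma gauss_deriv_measurable [measurable]: "gauss_deriv \<omega> \<delta> \<in> borel_measurable borel"
proof (rule borel_measurable_continuous_onI)
  show "continuous_on UNIV (gauss_deriv \<omega> \<delta>)"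
    unfolding gauss_deriv_def gauss_kernel_def by (cases "\<omega> = 0") (auto intro!: continuous_intros)
qed

text \<open>One majorant for all shifts of length at most 1, as required for the differentiation in
  \<open>t\<close> with \<open>v = t *\<^sub>R axis j 1\<close>. From |z|^2 \<le> 2 |z + v|^2 + 2
  one gets exp(- a |z + v|^2) \<le> exp(a) exp(- (a / 2) |z|^2), which is the source of the
  constants in \<open>?g\<close>.\<close>

lemma gauss_deriv_dominated:
  assumes "Re \<omega> > 0"
  obtains g :: "real ^ 'n \<Rightarrow> real" and B where "integrable lborel g" "\<And>z. norm (g z) \<le> B"
    "\<And>z v. norm v \<le> 1 \<Longrightarrow> norm (gauss_deriv \<omega> \<delta> (z + v)) \<le> g z"
proof -
  obtain C a where C: "C \<ge> 0" and a: "a > 0"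
    and bound: "\<And>z :: real ^ 'n. norm (gauss_deriv \<omega> \<delta> z) \<le> C * exp (- a * (norm z)\<^sup>2)"
    using gauss_deriv_bound[OF assms] by metis
  let ?g = "\<lambda>z :: real ^ 'n. (C * exp a) * exp (- (a / 2) * (norm z)\<^sup>2)"
  have "norm (gauss_deriv \<omega> \<delta> (z + v)) \<le> ?g z" if v: "norm v \<le> 1" for z v :: "real ^ 'n"
  proof -
    have "(norm z)\<^sup>2 \<le> (norm (z + v) + norm v)\<^sup>2"
      using norm_triangle_ineq4[of "z + v" v] by (intro power_mono) auto
    also have "\<dots> \<le> 2 * (norm (z + v))\<^sup>2 + 2 * (norm v)\<^sup>2"
      using zero_le_power2[of "norm (z + v) - norm v"] by (simp add: power2_sum power2_diff)
    also have "\<dots> \<le> 2 * (norm (z + v))\<^sup>2 + 2"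
      using v by (simp add: power_le_one)
    finally have "a * (norm z)\<^sup>2 \<le> a * (2 * (norm (z + v))\<^sup>2 + 2)"
      using a by (intro mult_left_mono) auto
    then have "exp (- a * (norm (z + v))\<^sup>2) \<le> exp (a + - (a / 2) * (norm z)\<^sup>2)"
      by (simp add: algebra_simps)
    from mult_left_mono[OF this C] have "C * exp (- a * (norm (z + v))\<^sup>2) \<le> ?g z"
      by (simp only: exp_add mult.assoc)
    with bound show ?thesis by (rule order_trans)
  qed
  moreover have "integrable lborel ?g"
    using integrable_gaussian[of "a / 2"] a by (intro integrable_mult_right) auto
  moreover have "norm (?g z) \<le> C * exp a" for z
    using C a by (simp add: abs_mult mult_left_le)
  ultimately show ?thesis using that by blast
qed

lemma gauss_deriv_integrable:
  assumes "Re \<omega> > 0"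
  shows "integrable lborel (gauss_deriv \<omega> \<delta> :: real ^ 'n \<Rightarrow> complex)"
    and "\<exists>B. \<forall>z :: real ^ 'n. norm (gauss_deriv \<omega> \<delta> z) \<le> B"
proof -
  obtain g :: "real ^ 'n \<Rightarrow> real" and B where g: "integrable lborel g" "\<And>z. norm (g z) \<le> B"
    "\<And>z v. norm v \<le> 1 \<Longrightarrow> norm (gauss_deriv \<omega> \<delta> (z + v)) \<le> g z"
    using gauss_deriv_dominated[OF assms] by metis
  have le: "norm (gauss_deriv \<omega> \<delta> z) \<le> norm (g z)" for z
    using g(3)[of 0 z] by simp
  show "integrable lborel (gauss_deriv \<omega> \<delta> :: real ^ 'n \<Rightarrow> complex)"
    using g(1) by (rule Bochner_Integration.integrable_bound) (auto simp: le[simplified])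
  show "\<exists>B. \<forall>z :: real ^ 'n. norm (gauss_deriv \<omega> \<delta> z) \<le> B"
    using order_trans[OF le g(2)] by blast
qed

lemma gauss_deriv_mult_integrable:
  assumes "Re \<omega> > 0" "1 \<le> q" "\<psi> \<in> Lq q"
  shows "integrable lebesgue (\<lambda>y. gauss_deriv \<omega> \<delta> (x - y) * \<psi> y)"
proof -
  obtain B where "\<And>z. norm (gauss_deriv \<omega> \<delta> z) \<le> B"
    using gauss_deriv_integrable(2)[OF assms(1)] by metis
  then show ?thesis
    by (intro integrable_mult_Lq[OF assms(2,3) integrable_lborel_reflect] gauss_deriv_integrable assms)
qed

lemma pderiv_at_convolution_gauss_deriv:
  fixes \<psi> :: "real ^ 'n \<Rightarrow> complex"
  assumes \<omega>: "Re \<omega> > 0" and q: "1 \<le> q" and \<psi>: "\<psi> \<in> Lq q"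
  shows "pderiv_at j (convolution (gauss_deriv \<omega> \<delta>) \<psi>)
    = convolution (gauss_deriv \<omega> (\<delta>(j := Suc (\<delta> j)))) \<psi>"
proof
  fix x :: "real ^ 'n"
  let ?\<delta> = "\<delta>(j := Suc (\<delta> j))"
  obtain g :: "real ^ 'n \<Rightarrow> real" and B where g: "integrable lborel g" "\<And>z. norm (g z) \<le> B"
    "\<And>z v. norm v \<le> 1 \<Longrightarrow> norm (gauss_deriv \<omega> ?\<delta> (z + v)) \<le> g z"
    using gauss_deriv_dominated[OF \<omega>] by metis
  have "\<omega> \<noteq> 0" using \<omega> by auto
  let ?e = "axis j 1 :: real ^ 'n"
  have [measurable]: "\<psi> \<in> borel_measurable lebesgue"
    using \<psi> by (rule Lq_measurable)
  have "((\<lambda>t. \<integral>y. gauss_deriv \<omega> \<delta> (x + t *\<^sub>R ?e - y) * \<psi> y \<partial>lebesgue) has_vector_derivative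
    (\<integral>y. gauss_deriv \<omega> ?\<delta> (x + 0 *\<^sub>R ?e - y) * \<psi> y \<partial>lebesgue)) (at 0)"
  \<comment> \<open>The majorant is integrable because \<open>g\<close> is itself integrable and
    bounded; it is coerced to complex values so that \<open>integrable_mult_Lq\<close> covers
    it.\<close>
  proof (rule has_vector_derivative_lebesgue_integral[where g="\<lambda>y. norm (complex_of_real (g (x - y)) * \<psi> y)" and
      f'="\<lambda>t y. gauss_deriv \<omega> ?\<delta> (x + t *\<^sub>R ?e - y) * \<psi> y"])
    show "integrable lebesgue (\<lambda>y. gauss_deriv \<omega> \<delta> (x + t *\<^sub>R ?e - y) * \<psi> y)" for t
      using \<omega> q \<psi> by (rule gauss_deriv_mult_integrable)
    have "((\<lambda>s. gauss_deriv \<omega> \<delta> (x + s *\<^sub>R ?e - y)) has_vector_derivative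
        gauss_deriv \<omega> ?\<delta> (x + t *\<^sub>R ?e - y)) (at t)" for t y
      using has_vector_derivative_gauss_deriv[OF \<open>\<omega> \<noteq> 0\<close>, of \<delta> "x - y" j t]
      by (simp add: algebra_simps)
    then show "((\<lambda>s. gauss_deriv \<omega> \<delta> (x + s *\<^sub>R ?e - y) * \<psi> y) has_vector_derivative
        gauss_deriv \<omega> ?\<delta> (x + t *\<^sub>R ?e - y) * \<psi> y) (at t)" for t y
      by (rule has_vector_derivative_mult_left)
    show "(\<lambda>y. gauss_deriv \<omega> ?\<delta> (x + 0 *\<^sub>R ?e - y) * \<psi> y) \<in> borel_measurable lebesgue"
      by (rule borel_measurable_integrable[OF gauss_deriv_mult_integrable[OF \<omega> q \<psi>]])
    have "integrable lebesgue (\<lambda>y. complex_of_real (g (x - y)) * \<psi> y)"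
      using g by (intro integrable_mult_Lq[OF q \<psi>, where B=B] integrable_lborel_reflect integrable_of_real)
        (auto intro: integrable_lborel_reflect integrable_of_real)
    then show "integrable lebesgue (\<lambda>y. norm (complex_of_real (g (x - y)) * \<psi> y))"
      by (rule integrable_norm)
    show "norm (gauss_deriv \<omega> ?\<delta> (x + t *\<^sub>R ?e - y) * \<psi> y) \<le> norm (complex_of_real (g (x - y)) * \<psi> y)"
      if "\<bar>t\<bar> \<le> 1" for t y
    proof -
      have "norm (gauss_deriv \<omega> ?\<delta> ((x - y) + t *\<^sub>R ?e)) \<le> \<bar>g (x - y)\<bar>"
        using that by (intro order_trans[OF g(3) abs_ge_self]) auto
      then show ?thesis
        unfolding norm_mult by (intro mult_right_mono) (simp_all add: algebra_simps)
    qed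
  qed
  then show "pderiv_at j (convolution (gauss_deriv \<omega> \<delta>) \<psi>) x = convolution (gauss_deriv \<omega> ?\<delta>) \<psi> x"
    by (simp add: pderiv_at_def convolution_def vector_derivative_at)
qed

text \<open>Each \<open>pderiv_at\<close> raises one index of the kernel, so iterating is
  bookkeeping: after the coordinates in \<open>js\<close> the order is \<open>\<beta>\<close> on
  \<open>js\<close> and 0 elsewhere. Distinctness ensures that every index is raised only
  once.\<close>

lemma mderiv_heat:
  fixes \<psi> :: "real ^ 'n \<Rightarrow> complex"
  assumes "Re \<omega> > 0" "1 \<le> q" "\<psi> \<in> Lq q"
  shows "mderiv \<beta> (heat \<omega> \<psi>) = convolution (gauss_deriv \<omega> \<beta>) \<psi>"
proof -
  have pow: "(pderiv_at j ^^ k) (convolution (gauss_deriv \<omega> \<delta>) \<psi>)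
      = convolution (gauss_deriv \<omega> (\<delta>(j := \<delta> j + k))) \<psi>" for j k \<delta>
  proof (induction k)
    case (Suc k)
    have "(pderiv_at j ^^ Suc k) (convolution (gauss_deriv \<omega> \<delta>) \<psi>)
        = convolution (gauss_deriv \<omega> ((\<delta>(j := \<delta> j + k))(j := Suc ((\<delta>(j := \<delta> j + k)) j)))) \<psi>"
      by (simp only: funpow.simps comp_apply Suc pderiv_at_convolution_gauss_deriv[OF assms])
    then show ?case by (simp only: fun_upd_upd fun_upd_same add_Suc_right)
  qed simp
  have "foldr (\<lambda>j D. (pderiv_at j ^^ \<beta> j) \<circ> D) js id (heat \<omega> \<psi>)
      = convolution (gauss_deriv \<omega> (\<lambda>j. if j \<in> set js then \<beta> j else 0)) \<psi>" if "distinct js" for js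
    using that
  proof (induction js)
    case Nil
    then show ?case by (simp add: heat_def gauss_deriv_0)
  next
    case (Cons j js)
    have "(\<lambda>i. if i \<in> set (j # js) then \<beta> i else 0)
        = (\<lambda>i. if i \<in> set js then \<beta> i else 0)(j := (if j \<in> set js then \<beta> j else 0) + \<beta> j)"
      using Cons.prems by auto
    then show ?case
      using Cons by (simp add: pow)
  qed
  from this[OF distinct_coords] show ?thesis
    by (simp add: mderiv_def set_coords)
qed

section \<open>Hermite-type expansion of monomials\<close>

text \<open>The value 0 outside \<open>2 * i \<le> k\<close> masks the truncated subtraction in
  \<open>k - 2 * i\<close> and permits summation up to any sufficiently large bound.\<close>

definition herm_coeff :: "complex \<Rightarrow> nat \<Rightarrow> nat \<Rightarrow> complex" where
  "herm_coeff \<omega> k i = (if 2 * i \<le> k then fact k / (fact i * fact (k - 2 * i)) * \<omega> ^ i else 0)"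

lemma herm_coeff_0: "herm_coeff \<omega> k 0 = 1"
  by (simp add: herm_coeff_def)

text \<open>Comparison of coefficients in the recurrence for monomials. The cases are: all three
  terms vanish, only the middle one vanishes, none vanishes.\<close>

lemma herm_coeff_rec:
  "herm_coeff \<omega> (k + 2) (Suc i) = herm_coeff \<omega> (k + 1) (Suc i) + 2 * \<omega> * of_nat (k + 1) * herm_coeff \<omega> k i"
proof -
  have nz: "1 + complex_of_nat d \<noteq> 0" for d
    using of_nat_neq_0[of d, where 'a=complex] by simp
  consider "k < 2 * i" | "k = 2 * i" | "k = 2 * i + 1 + (k - 2 * i - 1)" by linarith
  then show ?thesis
  proof cases
    case 3
    define d where "d = k - 2 * i - 1"
    have k: "k = 2 * i + 1 + d" using 3 by (simp add: d_def)
    show ?thesis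
      unfolding k by (simp add: herm_coeff_def nz divide_simps) (simp add: algebra_simps)
  qed (auto simp: herm_coeff_def nz divide_simps)
qed

lemma smult_sum_right: "smult c (\<Sum>i\<in>I. f i) = (\<Sum>i\<in>I. smult c (f i))"
  by (induction I rule: infinite_finite_induct) (auto simp: smult_add_right)

text \<open>Stated for polynomials, with the kernel cancelled. The recurrence has two steps, hence
  the strong induction; \<open>N\<close> is free because the two induction hypotheses are used with
  bounds differing by one.\<close>

lemma monom_eq_gauss_poly_sum:
  assumes "\<omega> \<noteq> 0" "k \<le> N"
  shows "monom 1 k = (\<Sum>i\<le>N. smult (herm_coeff \<omega> k i * (- 2 * \<omega>) ^ (k - 2 * i)) (gauss_poly \<omega> (k - 2 * i)))"
  using assms(2)
proof (induction k arbitrary: N rule: less_induct)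
  case (less k)
  define H where "H k = smult ((- 2 * \<omega>) ^ k) (gauss_poly \<omega> k)" for k
  \<comment> \<open>\<open>T\<close> is D = -2 \<omega> d/dz conjugated by the Gaussian: D (p G) =
    (T p) G. Thus \<open>H k\<close> is the polynomial factor of D^k G.\<close>
  define T where "T p = pCons 0 p - smult (2 * \<omega>) (pderiv p)" for p :: "complex poly"
  have T_H: "T (H k) = H (Suc k)" for k
    using assms(1) by (simp add: T_def H_def pderiv_smult smult_diff_right algebra_simps)
  have "T 0 = 0" "T (p + r) = T p + T r" "T (smult c p) = smult c (T p)" for p r c
    using add_pCons[of 0 p 0 r]
    by (simp_all add: T_def pderiv_add pderiv_smult smult_add_right smult_diff_right mult.commute)
  then have T_sum: "T (\<Sum>i\<in>I. smult (c i) (p i)) = (\<Sum>i\<in>I. smult (c i) (T (p i)))" for I :: "nat set" and c p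
    by (induction I rule: infinite_finite_induct) auto
  have IH: "monom 1 l = (\<Sum>i\<le>M. smult (herm_coeff \<omega> l i) (H (l - 2 * i)))" if "l < k" "l \<le> M" for l M
    using less.IH[OF that] by (simp add: H_def)
  have "monom 1 k = (\<Sum>i\<le>N. smult (herm_coeff \<omega> k i) (H (k - 2 * i)))"
  proof -
    consider "k = 0" | "k = 1" | l where "k = l + 2"
      by (metis One_nat_def add_2_eq_Suc' nat.exhaust)
    then show ?thesis
    proof cases
      case 1
      then show ?thesis
        by (subst sum.remove[of _ 0]) (auto simp: H_def herm_coeff_def intro!: sum.neutral)
    next
      case 2
      then show ?thesis
        using assms(1)
        by (subst sum.remove[of _ 0]) (auto simp: H_def herm_coeff_def monom_altdef intro!: sum.neutral)
    next
      case 3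
      have N: "l + 2 \<le> N" using 3 less.prems by simp
      then obtain M where M: "N = Suc M" by (cases N) auto
      have mono: "monom 1 (l + 2) = T (monom 1 (l + 1)) + smult (2 * \<omega> * of_nat (l + 1)) (monom 1 l)"
        by (simp add: T_def pderiv_monom smult_monom monom_Suc[of 1 "Suc l"])
      have "T (monom 1 (l + 1)) = (\<Sum>i\<le>N. smult (herm_coeff \<omega> (l + 1) i) (T (H (l + 1 - 2 * i))))"
        using IH[of "l + 1" N] N 3 by (simp add: T_sum)
      also have "\<dots> = (\<Sum>i\<le>N. smult (herm_coeff \<omega> (l + 1) i) (H (l + 2 - 2 * i)))"
        \<comment> \<open>\<open>T\<close> raises the index correctly only if
          \<open>2 * i \<le> l + 1\<close>; otherwise the subtraction truncates, but the coefficient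
          is 0.\<close>
        by (intro sum.cong refl) (auto simp: T_H herm_coeff_def Suc_diff_le)
      also have "\<dots> = H (l + 2) + (\<Sum>i\<le>M. smult (herm_coeff \<omega> (l + 1) (Suc i)) (H (l - 2 * i)))"
        unfolding M sum.atMost_Suc_shift by (simp add: herm_coeff_0)
      finally have "monom 1 (l + 2) = H (l + 2) + (\<Sum>i\<le>M. smult (herm_coeff \<omega> (l + 2) (Suc i)) (H (l - 2 * i)))"
        unfolding mono using IH[of l M] N M 3
        by (simp add: herm_coeff_rec[of \<omega> l, simplified] smult_sum_right smult_add_left sum.distrib)
      also have "\<dots> = (\<Sum>i\<le>N. smult (herm_coeff \<omega> (l + 2) i) (H (l + 2 - 2 * i)))"
        unfolding M sum.atMost_Suc_shift by (simp add: herm_coeff_0)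
      finally show ?thesis using 3 by simp
    qed
  qed
  then show ?case by (simp add: H_def)
qed

lemma power_eq_gauss_poly_sum:
  assumes "\<omega> \<noteq> 0"
  shows "z ^ k = (\<Sum>i | 2 * i \<le> k. fact k / (fact i * fact (k - 2 * i)) * \<omega> ^ i
    * (- 2 * \<omega>) ^ (k - 2 * i) * poly (gauss_poly \<omega> (k - 2 * i)) z)"
proof -
  have "z ^ k = (\<Sum>i\<le>k. herm_coeff \<omega> k i * (- 2 * \<omega>) ^ (k - 2 * i) * poly (gauss_poly \<omega> (k - 2 * i)) z)"
    using arg_cong[OF monom_eq_gauss_poly_sum[OF assms order_refl], of "\<lambda>p. poly p z"]
    by (simp add: poly_monom poly_sum)
  also have "\<dots> = (\<Sum>i | 2 * i \<le> k. herm_coeff \<omega> k i * (- 2 * \<omega>) ^ (k - 2 * i) * poly (gauss_poly \<omega> (k - 2 * i)) z)"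
    by (rule sum.mono_neutral_right) (auto simp: herm_coeff_def)
  finally show ?thesis
    by (simp add: herm_coeff_def)
qed

lemma finite_multi_index_le: "finite {\<kappa> :: 'n::finite multi_index. \<forall>j. \<kappa> j \<le> \<alpha> j}"
proof -
  have "{\<kappa>. \<forall>j. \<kappa> j \<le> \<alpha> j} = PiE UNIV (\<lambda>j. {..\<alpha> j})"
    by (auto simp: PiE_def)
  then show ?thesis by (simp add: finite_PiE)
qed

text \<open>The one-variable expansion in each coordinate; multiplying out the product of sums over
  \<open>i\<close> gives one summand for each choice function \<open>\<kappa>\<close>.\<close>

lemma mpow_mult_gauss_kernel:
  fixes z :: "real ^ 'n"
  assumes "\<omega> \<noteq> 0"
  shows "of_real (mpow z \<beta>) * gauss_kernel \<omega> z = (\<Sum>\<kappa> | \<forall>j. 2 * \<kappa> j \<le> \<beta> j.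
    of_nat (mfact \<beta>) / of_nat (mfact \<kappa> * mfact (\<lambda>j. \<beta> j - 2 * \<kappa> j)) * \<omega> ^ mdeg \<kappa>
    * (- 2 * \<omega>) ^ mdeg (\<lambda>j. \<beta> j - 2 * \<kappa> j) * gauss_deriv \<omega> (\<lambda>j. \<beta> j - 2 * \<kappa> j) z)"
proof -
  let ?f = "\<lambda>j i. fact (\<beta> j) / (fact i * fact (\<beta> j - 2 * i)) * \<omega> ^ i
    * (- 2 * \<omega>) ^ (\<beta> j - 2 * i) * poly (gauss_poly \<omega> (\<beta> j - 2 * i)) (of_real (z $ j))"
  have "finite {i. 2 * i \<le> m}" for m :: nat
    by (rule finite_subset[of _ "{..m}"]) auto
  note fin = this
  have "complex_of_real (mpow z \<beta>) = (\<Prod>j\<in>UNIV. \<Sum>i | 2 * i \<le> \<beta> j. ?f j i)"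
    unfolding mpow_def of_real_prod of_real_power
    by (intro prod.cong refl power_eq_gauss_poly_sum assms)
  also have "\<dots> = (\<Sum>\<kappa>\<in>PiE UNIV (\<lambda>j. {i. 2 * i \<le> \<beta> j}). \<Prod>j\<in>UNIV. ?f j (\<kappa> j))"
    by (intro prod_sum_PiE fin) simp
  also have "PiE UNIV (\<lambda>j. {i. 2 * i \<le> \<beta> j}) = {\<kappa>. \<forall>j. 2 * \<kappa> j \<le> \<beta> j}"
    by (auto simp: PiE_def)
  finally have eq: "complex_of_real (mpow z \<beta>) = (\<Sum>\<kappa> | \<forall>j. 2 * \<kappa> j \<le> \<beta> j. \<Prod>j\<in>UNIV. ?f j (\<kappa> j))" .
  show ?thesis
    unfolding eq sum_distrib_right
    by (intro sum.cong refl)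
      (simp add: prod.distrib prod_dividef mfact_def mdeg_def power_sum gauss_deriv_def mult_ac)
qed

text \<open>The binomial theorem in each coordinate, multiplied out. The final reindexing by pairs
  matches the index set of \<open>R_op\<close>.\<close>

lemma mpow_add:
  fixes u v :: "real ^ 'n"
  shows "mpow (u + v) \<alpha> = (\<Sum>(\<beta>, \<gamma>) | (\<lambda>j. \<beta> j + \<gamma> j) = \<alpha>.
    real (mfact \<alpha>) / real (mfact \<beta> * mfact \<gamma>) * mpow u \<beta> * mpow v \<gamma>)"
proof -
  let ?f = "\<lambda>j i. fact (\<alpha> j) / (fact i * fact (\<alpha> j - i)) * (u $ j) ^ i * (v $ j) ^ (\<alpha> j - i)"
  have "(\<Sum>i\<le>\<alpha> j. real (\<alpha> j choose i) * (u $ j) ^ i * (v $ j) ^ (\<alpha> j - i)) = (\<Sum>i\<le>\<alpha> j. ?f j i)" for j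
    by (intro sum.cong refl) (simp add: binomial_fact)
  then have "mpow (u + v) \<alpha> = (\<Prod>j\<in>UNIV. \<Sum>i\<le>\<alpha> j. ?f j i)"
    by (simp only: mpow_def vector_add_component binomial_ring)
  also have "\<dots> = (\<Sum>\<beta>\<in>PiE UNIV (\<lambda>j. {..\<alpha> j}). \<Prod>j\<in>UNIV. ?f j (\<beta> j))"
    by (intro prod_sum_PiE) simp_all
  also have "PiE UNIV (\<lambda>j. {..\<alpha> j}) = {\<beta>. \<forall>j. \<beta> j \<le> \<alpha> j}"
    by (auto simp: PiE_def)
  also have "(\<Sum>\<beta> | \<forall>j. \<beta> j \<le> \<alpha> j. \<Prod>j\<in>UNIV. ?f j (\<beta> j))
      = (\<Sum>\<beta> | \<forall>j. \<beta> j \<le> \<alpha> j. real (mfact \<alpha>) / real (mfact \<beta> * mfact (\<lambda>j. \<alpha> j - \<beta> j))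
          * mpow u \<beta> * mpow v (\<lambda>j. \<alpha> j - \<beta> j))"
    by (simp add: prod.distrib prod_dividef mfact_def mpow_def)
  also have "\<dots> = (\<Sum>(\<beta>, \<gamma>) | (\<lambda>j. \<beta> j + \<gamma> j) = \<alpha>.
    real (mfact \<alpha>) / real (mfact \<beta> * mfact \<gamma>) * mpow u \<beta> * mpow v \<gamma>)"
    by (rule sum.reindex_bij_witness[where i=fst and j="\<lambda>\<beta>. (\<beta>, \<lambda>j. \<alpha> j - \<beta> j)"]) auto
  finally show ?thesis .
qed

lemma finite_multi_index_sum: "finite {(\<beta>, \<gamma>). (\<lambda>j. \<beta> j + \<gamma> j) = (\<alpha> :: 'n::finite multi_index)}"
  by (rule finite_subset[OF _ finite_cartesian_product[OF finite_multi_index_le[of \<alpha>] finite_multi_index_le[of \<alpha>]]]) auto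

section \<open>The commutator\<close>

text \<open>The sum of \<open>R_op\<close> completed by \<beta> = 0. Only weights
  \<open>\<gamma>\<close> below \<open>\<alpha>\<close> occur, and each summand is integrable on its
  own, so the finite sums leave the integral.\<close>

lemma xmult_heat_expansion:
  fixes \<phi> :: "real ^ 'n \<Rightarrow> complex"
  assumes \<omega>: "Re \<omega> > 0" and q: "1 \<le> q"
    and \<phi>: "\<And>\<gamma>. (\<And>j. \<gamma> j \<le> \<alpha> j) \<Longrightarrow> xmult \<gamma> \<phi> \<in> Lq q"
  shows "xmult \<alpha> (heat \<omega> \<phi>) x = (\<Sum>(\<beta>, \<gamma>) \<in> {(\<beta>, \<gamma>). (\<lambda>j. \<beta> j + \<gamma> j) = \<alpha>}.
     \<Sum>\<kappa> \<in> {\<kappa>. \<forall>j. 2 * \<kappa> j \<le> \<beta> j}.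
       of_nat (mfact \<alpha>) / of_nat (mfact \<gamma> * mfact \<kappa> * mfact (\<lambda>j. \<beta> j - 2 * \<kappa> j))
       * \<omega> ^ mdeg \<kappa>
       * scaled_mderiv (- 2 * \<omega>) (\<lambda>j. \<beta> j - 2 * \<kappa> j) (heat \<omega> (xmult \<gamma> \<phi>)) x)"
    (is "_ = (\<Sum>(\<beta>, \<gamma>) \<in> ?P. \<Sum>\<kappa> \<in> ?K \<beta>. ?c \<beta> \<gamma> \<kappa> * \<omega> ^ mdeg \<kappa> * _)")
proof -
  have "\<omega> \<noteq> 0" using \<omega> by auto
  let ?d = "\<lambda>\<beta> \<gamma> \<kappa>. ?c \<beta> \<gamma> \<kappa> * \<omega> ^ mdeg \<kappa> * (- 2 * \<omega>) ^ mdeg (\<lambda>j. \<beta> j - 2 * \<kappa> j)"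
  let ?g = "\<lambda>\<beta> \<gamma> \<kappa> y. gauss_deriv \<omega> (\<lambda>j. \<beta> j - 2 * \<kappa> j) (x - y) * xmult \<gamma> \<phi> y"
  have L: "xmult \<gamma> \<phi> \<in> Lq q" if "(\<beta>, \<gamma>) \<in> ?P" for \<beta> \<gamma>
    using that by (intro \<phi>) auto
  have int: "integrable lebesgue (?g \<beta> \<gamma> \<kappa>)" if "(\<beta>, \<gamma>) \<in> ?P" for \<beta> \<gamma> \<kappa>
    using \<omega> q L[OF that] by (rule gauss_deriv_mult_integrable)
  have mfact_nz: "mfact \<delta> \<noteq> 0" for \<delta> :: "'n multi_index"
    by (simp add: mfact_def)
  have "of_real (mpow x \<alpha>) * (gauss_kernel \<omega> (x - y) * \<phi> y)
      = (\<Sum>(\<beta>, \<gamma>)\<in>?P. \<Sum>\<kappa>\<in>?K \<beta>. ?d \<beta> \<gamma> \<kappa> * ?g \<beta> \<gamma> \<kappa> y)" for y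
  proof -
    have eq: "complex_of_real (mpow x \<alpha>)
        = (\<Sum>(\<beta>, \<gamma>)\<in>?P. of_nat (mfact \<alpha>) / of_nat (mfact \<beta> * mfact \<gamma>) * of_real (mpow (x - y) \<beta>) * of_real (mpow y \<gamma>))"
      using mpow_add[of "x - y" y \<alpha>] by (simp add: case_prod_beta)
    have "of_real (mpow x \<alpha>) * (gauss_kernel \<omega> (x - y) * \<phi> y)
        = (\<Sum>(\<beta>, \<gamma>)\<in>?P. (of_nat (mfact \<alpha>) / of_nat (mfact \<beta> * mfact \<gamma>) * xmult \<gamma> \<phi> y)
            * (of_real (mpow (x - y) \<beta>) * gauss_kernel \<omega> (x - y)))"
      unfolding eq sum_distrib_right
      by (intro sum.cong refl) (simp add: case_prod_beta xmult_def)
    also have "\<dots> = (\<Sum>(\<beta>, \<gamma>)\<in>?P. \<Sum>\<kappa>\<in>?K \<beta>. ?d \<beta> \<gamma> \<kappa> * ?g \<beta> \<gamma> \<kappa> y)"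
      unfolding mpow_mult_gauss_kernel[OF \<open>\<omega> \<noteq> 0\<close>] sum_distrib_left
      \<comment> \<open>Here \<open>mfact \<beta>\<close> cancels between the multinomial
        coefficient and the expansion of the monomial.\<close>
      by (intro sum.cong refl) (auto simp: mfact_nz mult_ac intro!: sum.cong)
    finally show ?thesis .
  qed
  note eq = this
  have "xmult \<alpha> (heat \<omega> \<phi>) x = (\<integral>y. of_real (mpow x \<alpha>) * (gauss_kernel \<omega> (x - y) * \<phi> y) \<partial>lebesgue)"
    by (simp only: xmult_def heat_def convolution_def integral_mult_right_zero)
  also have "\<dots> = (\<integral>y. (\<Sum>(\<beta>, \<gamma>)\<in>?P. \<Sum>\<kappa>\<in>?K \<beta>. ?d \<beta> \<gamma> \<kappa> * ?g \<beta> \<gamma> \<kappa> y) \<partial>lebesgue)"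
    by (simp only: eq)
  also have "\<dots> = (\<Sum>(\<beta>, \<gamma>)\<in>?P. \<Sum>\<kappa>\<in>?K \<beta>. ?d \<beta> \<gamma> \<kappa> * (\<integral>y. ?g \<beta> \<gamma> \<kappa> y \<partial>lebesgue))"
  proof -
    have "integrable lebesgue (\<lambda>y. ?d \<beta> \<gamma> \<kappa> * ?g \<beta> \<gamma> \<kappa> y)" if "(\<beta>, \<gamma>) \<in> ?P" for \<beta> \<gamma> \<kappa>
      using int[OF that] by (intro integrable_mult_right)
    then have *: "integrable lebesgue (\<lambda>y. \<Sum>\<kappa>\<in>?K \<beta>. ?d \<beta> \<gamma> \<kappa> * ?g \<beta> \<gamma> \<kappa> y)"
      "(\<integral>y. (\<Sum>\<kappa>\<in>?K \<beta>. ?d \<beta> \<gamma> \<kappa> * ?g \<beta> \<gamma> \<kappa> y) \<partial>lebesgue) = (\<Sum>\<kappa>\<in>?K \<beta>. ?d \<beta> \<gamma> \<kappa> * (\<integral>y. ?g \<beta> \<gamma> \<kappa> y \<partial>lebesgue))"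
      if "(\<beta>, \<gamma>) \<in> ?P" for \<beta> \<gamma>
      using that by (auto simp: Bochner_Integration.integral_sum)
    show ?thesis
      unfolding case_prod_beta
      by (subst Bochner_Integration.integral_sum) (use * in \<open>auto simp: intro!: sum.cong\<close>)
  qed
  also have "\<dots> = (\<Sum>(\<beta>, \<gamma>)\<in>?P. \<Sum>\<kappa>\<in>?K \<beta>. ?c \<beta> \<gamma> \<kappa> * \<omega> ^ mdeg \<kappa>
       * scaled_mderiv (- 2 * \<omega>) (\<lambda>j. \<beta> j - 2 * \<kappa> j) (heat \<omega> (xmult \<gamma> \<phi>)) x)"
    by (intro sum.cong refl)
      (auto simp: scaled_mderiv_def mderiv_heat[OF \<omega> q L] convolution_def intro!: sum.cong)
  finally show ?thesis .
qed

lemma convolution_gauss_deriv_Lq: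
  fixes \<psi> :: "real ^ 'n \<Rightarrow> complex"
  assumes "Re \<omega> > 0" "1 \<le> q" "\<psi> \<in> Lq q"
  shows "convolution (gauss_deriv \<omega> \<delta>) \<psi> \<in> Lq q"
proof -
  obtain B where "\<And>z :: real ^ 'n. norm (gauss_deriv \<omega> \<delta> z) \<le> B"
    using gauss_deriv_integrable(2)[OF assms(1)] by metis
  then show ?thesis
    by (rule convolution_Lq[OF assms(2,3) gauss_deriv_integrable(1)[OF assms(1)]])
qed

theorem theorem1p1:
  fixes \<omega> :: complex and q :: ennreal and m :: nat
    and \<alpha> :: "'n::finite multi_index" and \<phi> :: "real ^ 'n \<Rightarrow> complex"
  assumes "Re \<omega> > 0" and "1 \<le> q" and "m > 0" and "mdeg \<alpha> = m"
    and "\<phi> \<in> Lq_weighted q m"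
  shows "xmult \<alpha> (heat \<omega> \<phi>) \<in> Lq q
    \<and> heat_commutator \<alpha> \<omega> \<phi> \<in> Lq q
    \<and> R_op \<alpha> \<omega> \<phi> \<in> Lq q
    \<and> (AE x in lebesgue. heat_commutator \<alpha> \<omega> \<phi> x = R_op \<alpha> \<omega> \<phi> x)"
proof -
  have L: "xmult \<gamma> \<phi> \<in> Lq q" if "\<And>j. \<gamma> j \<le> \<alpha> j" for \<gamma>
  proof -
    have "mdeg \<gamma> \<le> m"
      using that assms(4) by (auto simp: mdeg_def intro: sum_mono)
    then show ?thesis
      using assms(5) by (simp add: Lq_weighted_def)
  qed
  let ?t = "\<lambda>\<beta> \<gamma> \<kappa> x. of_nat (mfact \<alpha>) / of_nat (mfact \<gamma> * mfact \<kappa> * mfact (\<lambda>j. \<beta> j - 2 * \<kappa> j))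
       * \<omega> ^ mdeg \<kappa>
       * scaled_mderiv (- 2 * \<omega>) (\<lambda>j. \<beta> j - 2 * \<kappa> j) (heat \<omega> (xmult \<gamma> \<phi>)) x"
  let ?P = "{(\<beta>, \<gamma>). (\<lambda>j. \<beta> j + \<gamma> j) = \<alpha>}"
  have R_eq: "R_op \<alpha> \<omega> \<phi> = (\<lambda>x. \<Sum>p\<in>?P - {(\<lambda>_. 0, \<alpha>)}. \<Sum>\<kappa>\<in>{\<kappa>. \<forall>j. 2 * \<kappa> j \<le> fst p j}. ?t (fst p) (snd p) \<kappa> x)"
  proof -
    have "{(\<beta>, \<gamma>). (\<lambda>j. \<beta> j + \<gamma> j) = \<alpha> \<and> \<beta> \<noteq> (\<lambda>_. 0)} = ?P - {(\<lambda>_. 0, \<alpha>)}"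
      by auto
    then show ?thesis
      by (simp add: R_op_def case_prod_beta)
  qed
  have comm: "heat_commutator \<alpha> \<omega> \<phi> = R_op \<alpha> \<omega> \<phi>"
  proof
    fix x
    have "xmult \<alpha> (heat \<omega> \<phi>) x = (\<Sum>p\<in>?P. \<Sum>\<kappa>\<in>{\<kappa>. \<forall>j. 2 * \<kappa> j \<le> fst p j}. ?t (fst p) (snd p) \<kappa> x)"
      using xmult_heat_expansion[OF assms(1,2) L] by (simp add: case_prod_beta)
    also have "\<dots> = (\<Sum>\<kappa>\<in>{\<kappa>. \<forall>j. 2 * \<kappa> j \<le> 0}. ?t (\<lambda>_. 0) \<alpha> \<kappa> x) + R_op \<alpha> \<omega> \<phi> x"
      unfolding R_eq by (subst sum.remove[OF finite_multi_index_sum, of "(\<lambda>_. 0, \<alpha>)"]) auto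
    also have "{\<kappa> :: 'n multi_index. \<forall>j. 2 * \<kappa> j \<le> 0} = {\<lambda>_. 0}"
      by auto
    also have "(\<Sum>\<kappa>\<in>{\<lambda>_. 0}. ?t (\<lambda>_. 0) \<alpha> \<kappa> x) = heat \<omega> (xmult \<alpha> \<phi>) x"
      using mderiv_heat[OF assms(1,2) L[of \<alpha>], of "\<lambda>_. 0"]
      by (simp add: mfact_def mdeg_def scaled_mderiv_def gauss_deriv_0 heat_def)
    finally show "heat_commutator \<alpha> \<omega> \<phi> x = R_op \<alpha> \<omega> \<phi> x"
      by (simp add: heat_commutator_def)
  qed
  have R: "R_op \<alpha> \<omega> \<phi> \<in> Lq q"
    unfolding R_eq
  proof (intro Lq_sum Lq_cmult)
    fix p \<kappa> assume "p \<in> ?P - {(\<lambda>_. 0, \<alpha>)}"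
    then have "xmult (snd p) \<phi> \<in> Lq q"
      by (intro L) auto
    then show "scaled_mderiv (- 2 * \<omega>) (\<lambda>j. fst p j - 2 * \<kappa> j) (heat \<omega> (xmult (snd p) \<phi>)) \<in> Lq q"
      unfolding scaled_mderiv_def
      by (intro Lq_cmult) (simp add: mderiv_heat[OF assms(1,2)] convolution_gauss_deriv_Lq assms)
  qed
  have "heat \<omega> (xmult \<alpha> \<phi>) \<in> Lq q"
    using convolution_gauss_deriv_Lq[OF assms(1,2) L, of \<alpha> "\<lambda>_. 0"] by (simp add: heat_def gauss_deriv_0)
  then have "(\<lambda>x. R_op \<alpha> \<omega> \<phi> x + heat \<omega> (xmult \<alpha> \<phi>) x) \<in> Lq q"
    using R by (rule Lq_add[rotated])
  \<comment> \<open>Membership of the weighted convolution in \<open>Lq\<close> is read off from the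
    identity, since every term on the right is a combination of convolutions with weighted
    data.\<close>
  moreover have "xmult \<alpha> (heat \<omega> \<phi>) = (\<lambda>x. R_op \<alpha> \<omega> \<phi> x + heat \<omega> (xmult \<alpha> \<phi>) x)"
    by (simp add: heat_commutator_def flip: comm)
  ultimately show ?thesis
    using R comm by simp
qed

end
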